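(* The elliptic quadric $\mathcal Q^-(7,2)$ has a non-trivial $m$-ovoid only for $m=3$ and $m=4$. Moreover, every $3$-ovoid of $\mathcal Q^-(7,2)$ is the union of the lines of a $1$-system of $\mathcal Q^-(7,2)$.
   Context: $\mathcal Q^-(7,q)$ is the elliptic quadric of rank $3$ in $\mathrm{PG}(7,q)$ (points singular for a non-degenerate quadratic form of Witt index $3$ on $\mathbb F_q^{8}$); its generators are the planes contained in it. An $m$-ovoid is a set of points of the quadric meeting every generator in exactly $m$ points; it is trivial if it is empty ($m=0$) or the whole point set ($m=q^2+q+1$). A $1$-system of $\mathcal Q^-(7,q)$ is a set of $q^4+1$ pairwise disjoint lines $\ell_1,\dots,\ell_{q^4+1}$ contained in the quadric such that every plane of the quadric containing some $\ell_i$ is disjoint from $\bigcup_{j\ne i}\ell_j$. *)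

theory Defs
  imports "HOL-Analysis.Analysis" "HOL-Library.Z2"
begin

instance bit :: finite
proof
  have "(UNIV :: bit set) = {0, 1}" by auto
  then show "finite (UNIV :: bit set)" by (metis finite.emptyI finite.insertI)
qed

text \<open>Quadratic forms on a coordinate space over a field of arbitrary characteristic.\<close>

definition polar :: "('a::field ^ 'n \<Rightarrow> 'a) \<Rightarrow> 'a ^ 'n \<Rightarrow> 'a ^ 'n \<Rightarrow> 'a" where
  "polar Q x y = Q (x + y) - Q x - Q y"

text \<open>The polar form is symmetric by definition, so linearity in the second argument
  makes it bilinear.\<close>

definition quadratic_form :: "('a::field ^ 'n \<Rightarrow> 'a) \<Rightarrow> bool" where
  "quadratic_form Q \<longleftrightarrow>
     (\<forall>c x. Q (c *s x) = c\<^sup>2 * Q x) \<and>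
     (\<forall>x. Vector_Spaces.linear (*s) (*) (polar Q x))"

text \<open>Non-degeneracy of the form (not of its polar form): the radical of the polar form
  contains no non-zero singular vector.  In even dimension over a finite field this is
  equivalent to non-degeneracy of the polar form, in characteristic 2 as well.\<close>

definition nondegenerate :: "('a::field ^ 'n \<Rightarrow> 'a) \<Rightarrow> bool" where
  "nondegenerate Q \<longleftrightarrow> (\<forall>x. Q x = 0 \<and> (\<forall>y. polar Q x y = 0) \<longrightarrow> x = 0)"

definition totally_singular :: "('a::field ^ 'n \<Rightarrow> 'a) \<Rightarrow> ('a ^ 'n) set \<Rightarrow> bool" where
  "totally_singular Q W \<longleftrightarrow> vec.subspace W \<and> (\<forall>w\<in>W. Q w = 0)"

definition witt_index :: "('a::field ^ 'n \<Rightarrow> 'a) \<Rightarrow> nat" where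
  "witt_index Q = Max {vec.dim W | W. totally_singular Q W}"

definition elliptic_form :: "('a::{field,finite} ^ 8 \<Rightarrow> 'a) \<Rightarrow> bool" where
  "elliptic_form Q \<longleftrightarrow> quadratic_form Q \<and> nondegenerate Q \<and> witt_index Q = 3"

text \<open>Points, lines and planes of the projective space are vector subspaces of dimension
  1, 2 and 3.  The same subspaces, when totally singular, are those of the quadric.\<close>

definition points_on :: "('a::field ^ 'n) set \<Rightarrow> ('a ^ 'n) set set" where
  "points_on W = {P. vec.subspace P \<and> vec.dim P = 1 \<and> P \<subseteq> W}"

definition quadric_points :: "('a::field ^ 'n \<Rightarrow> 'a) \<Rightarrow> ('a ^ 'n) set set" where
  "quadric_points Q = {P. totally_singular Q P \<and> vec.dim P = 1}"

definition quadric_lines :: "('a::field ^ 'n \<Rightarrow> 'a) \<Rightarrow> ('a ^ 'n) set set" where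
  "quadric_lines Q = {l. totally_singular Q l \<and> vec.dim l = 2}"

definition quadric_planes :: "('a::field ^ 'n \<Rightarrow> 'a) \<Rightarrow> ('a ^ 'n) set set" where
  "quadric_planes Q = {\<pi>. totally_singular Q \<pi> \<and> vec.dim \<pi> = 3}"

text \<open>The notions below are meant for an elliptic form \<open>Q\<close>, in which case the generators
  of the quadric are its planes.\<close>

definition m_ovoid :: "('a::{field,finite} ^ 8 \<Rightarrow> 'a) \<Rightarrow> nat \<Rightarrow> ('a ^ 8) set set \<Rightarrow> bool" where
  "m_ovoid Q m X \<longleftrightarrow>
     X \<subseteq> quadric_points Q \<and> (\<forall>\<pi>\<in>quadric_planes Q. card (X \<inter> points_on \<pi>) = m)"

definition trivial_ovoid :: "('a::{field,finite} ^ 8 \<Rightarrow> 'a) \<Rightarrow> ('a ^ 8) set set \<Rightarrow> bool" where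
  "trivial_ovoid Q X \<longleftrightarrow> X = {} \<or> X = quadric_points Q"

definition one_system :: "('a::{field,finite} ^ 8 \<Rightarrow> 'a) \<Rightarrow> ('a ^ 8) set set \<Rightarrow> bool" where
  "one_system Q L \<longleftrightarrow>
     L \<subseteq> quadric_lines Q \<and> card L = CARD('a) ^ 4 + 1 \<and>
     pairwise (\<lambda>l l'. disjnt (points_on l) (points_on l')) L \<and>
     (\<forall>l\<in>L. \<forall>\<pi>\<in>quadric_planes Q. l \<subseteq> \<pi> \<longrightarrow>
        disjnt (points_on \<pi>) (\<Union>l'\<in>L - {l}. points_on l'))"

end

theory Submission
  imports Defs
begin

text \<open>
  Over the field with two elements a point is a non-zero vector, so an \<open>m\<close>-ovoid is a set \<open>Y\<close> of
  singular vectors.  Fix a singular \<open>x\<close> and give a point of the generalized quadrangle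
  \<open>x\<^sup>\<bottom>/x\<close> of order \<open>(2,4)\<close> the number of points of \<open>Y\<close> other than \<open>x\<close> on the corresponding line
  through \<open>x\<close>.  Every line of the quadrangle then has total weight \<open>s = m\<close>, or \<open>s = m - 1\<close> if
  \<open>x \<in> Y\<close>.  Two non-collinear points \<open>v\<close>, \<open>u\<close> cannot both have weight \<open>s > 0\<close>: for pairwise
  non-collinear \<open>s\<^sub>1, \<dots>, s\<^sub>4\<close> collinear with both, the points \<open>v + u + s\<^sub>1 + s\<^sub>2\<close> and
  \<open>v + u + s\<^sub>3 + s\<^sub>4\<close> would be collinear and of weight \<open>s\<close> as well.  Hence \<open>s = 1\<close> is impossible
  (the quadrangle has no ovoid), which excludes \<open>m = 1\<close> (take \<open>x \<notin> Y\<close>) and \<open>m = 2\<close> (take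
  \<open>x \<in> Y\<close>), and \<open>m = 5, 6\<close> by taking complements.  For \<open>s = 2\<close> exactly one point has weight \<open>2\<close>,
  so each point of a \<open>3\<close>-ovoid lies on exactly one line contained in it.

  A spread of \<open>17\<close> planes gives \<open>card Y = 17 m\<close> and hence \<open>17\<close> lines.  Existence for \<open>m = 3\<close>:
  if \<open>Y\<close> has \<open>51\<close> points and the perp of a singular point contains \<open>19\<close> or \<open>27\<close> of them according
  to whether the point is in \<open>Y\<close>, then counting the orthogonal pairs between \<open>Y\<close> and a plane
  shows that they share \<open>3\<close> points.
\<close>

section \<open>Elliptic spaces over the field with two elements\<close>

text \<open>A form with values in the two-element field is encoded as the predicate that its value is
  \<open>1\<close>, so that addition of values becomes \<open>\<noteq>\<close>.\<close>

definition add_closed :: "'v::ab_group_add set \<Rightarrow> bool" where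
  "add_closed W \<longleftrightarrow> 0 \<in> W \<and> (\<forall>x\<in>W. \<forall>y\<in>W. x + y \<in> W)"

definition tot_sing :: "('v::ab_group_add \<Rightarrow> bool) \<Rightarrow> 'v set \<Rightarrow> bool" where
  "tot_sing q W \<longleftrightarrow> add_closed W \<and> (\<forall>w\<in>W. \<not> q w)"

text \<open>Here \<open>q\<close> and \<open>b\<close> encode an elliptic form and its polar form:
  at most 8 elements means dimension at most 3, and 256 = 2^8.\<close>

locale elliptic_space =
  fixes q :: "'v::{ab_group_add,finite} \<Rightarrow> bool" and b :: "'v \<Rightarrow> 'v \<Rightarrow> bool"
  assumes double [simp]: "(x::'v) + x = 0"
    and q_add [simp]: "q (x + y) \<longleftrightarrow> (q x \<noteq> q y) \<noteq> b x y"
    and b_add_right [simp]: "b x (y + z) \<longleftrightarrow> b x y \<noteq> b x z"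
    and nondegenerate_b: "\<not> q x \<Longrightarrow> (\<And>y. \<not> b x y) \<Longrightarrow> x = 0"
    and tot_sing_card_le: "tot_sing q W \<Longrightarrow> card W \<le> 8"
    and card_space: "CARD('v) = 256"
begin

lemma double_left [simp]: "(x::'v) + (x + y) = y"
  using add.assoc[of x x y] by (simp only: double add_0_left)

lemma add_eq_0 [simp]: "(x::'v) + y = 0 \<longleftrightarrow> x = y"
  by (metis add_0_right double double_left)

lemma b_commute: "b x y \<longleftrightarrow> b y x"
  using q_add[of x y] q_add[of y x] by (auto simp: add.commute)

lemma b_zero [simp]: "\<not> b x 0" "\<not> b 0 x"
  using b_add_right[of x 0 0] b_commute by auto

lemma q_zero [simp]: "\<not> q 0"
  using q_add[of 0 0] by auto

lemma b_self [simp]: "\<not> b x x"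
  using q_add[of x x] by auto

lemma b_add_left [simp]: "b (x + y) z \<longleftrightarrow> b x z \<noteq> b y z"
  using b_commute by auto

lemma not_b_commute: "\<not> b x y \<Longrightarrow> \<not> b y x"
  using b_commute by blast

text \<open>In a frame, two vectors are told apart by a vector \<open>y\<close> that pairs
  differently with them.\<close>

lemma neq_by_b: "b y r \<Longrightarrow> \<not> b y s \<Longrightarrow> r \<noteq> s"
  by blast

section \<open>Splitting off non-degenerate planes\<close>

definition nondeg :: "'v set \<Rightarrow> bool" where
  "nondeg U \<longleftrightarrow> add_closed U \<and> (\<forall>x\<in>U. \<not> q x \<longrightarrow> (\<forall>y\<in>U. \<not> b x y) \<longrightarrow> x = 0)"

definition perp2 :: "'v \<Rightarrow> 'v \<Rightarrow> 'v set \<Rightarrow> 'v set" where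
  "perp2 x y U = {z \<in> U. \<not> b x z \<and> \<not> b y z}"

lemma nondeg_UNIV: "nondeg UNIV"
  using nondegenerate_b by (auto simp: nondeg_def add_closed_def)

text \<open>Translation by \<open>t\<close> exchanges the two values of \<open>g\<close>, so each
  value is taken on half of \<open>A\<close>.\<close>

lemma card_half:
  fixes A :: "'v set"
  assumes "\<And>z. z \<in> A \<Longrightarrow> z + t \<in> A" and flip: "\<And>z. z \<in> A \<Longrightarrow> g (z + t) \<longleftrightarrow> \<not> g z"
  shows "card A = 2 * card {z \<in> A. \<not> g z}"
proof -
  have "bij_betw (\<lambda>z. z + t) {z \<in> A. \<not> g z} {z \<in> A. g z}"
    by (rule bij_betw_byWitness[where f' = "\<lambda>z. z + t"]) (use assms in \<open>auto simp: add.assoc\<close>)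
  then have "card {z \<in> A. \<not> g z} = card {z \<in> A. g z}"
    by (rule bij_betw_same_card)
  moreover have "A = {z \<in> A. \<not> g z} \<union> {z \<in> A. g z}" by auto
  then have "card A = card {z \<in> A. \<not> g z} + card {z \<in> A. g z}"
    by (metis (no_types, lifting) card_Un_disjoint disjoint_iff finite mem_Collect_eq)
  ultimately show ?thesis by simp
qed

text \<open>\<open>U\<close> is the orthogonal sum of the plane spanned by \<open>x\<close> and
  \<open>y\<close> and its complement, so a radical vector of the complement is one of
  \<open>U\<close>. Each of the two orthogonality conditions halves the size.\<close>

lemma nondeg_perp2:
  assumes U: "nondeg U" and x: "x \<in> U" and y: "y \<in> U" and xy: "b x y"
  shows "nondeg (perp2 x y U)" "card U = 4 * card (perp2 x y U)"
proof -
  have cl: "\<And>v w. v \<in> U \<Longrightarrow> w \<in> U \<Longrightarrow> v + w \<in> U" and "0 \<in> U"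
    using U by (auto simp: nondeg_def add_closed_def)
  have yx: "b y x" using xy b_commute by blast
  show "nondeg (perp2 x y U)"
    unfolding nondeg_def
  proof (intro conjI ballI impI)
    show "add_closed (perp2 x y U)"
      using cl \<open>0 \<in> U\<close> by (auto simp: add_closed_def perp2_def)
    fix z assume z: "z \<in> perp2 x y U" and qz: "\<not> q z"
      and zz: "\<forall>w\<in>perp2 x y U. \<not> b z w"
    have zxy: "\<not> b z x" "\<not> b z y" using z b_commute by (auto simp: perp2_def)
    have "\<not> b z w" if w: "w \<in> U" for w
    proof -
      \<comment> \<open>Projection of \<open>w\<close> to the complement along the plane spanned by
        \<open>x\<close> and \<open>y\<close>.\<close>
      define w' where "w' = w + ((if b y w then x else 0) + (if b x w then y else 0))"
      have "w' \<in> perp2 x y U"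
        using w x y cl xy yx by (auto simp: w'_def perp2_def)
      then have "\<not> b z w'" using zz by blast
      then show ?thesis using zxy by (auto simp: w'_def split: if_splits)
    qed
    then show "z = 0" using U z qz by (auto simp: nondeg_def perp2_def)
  qed
  have "card U = 2 * card {z \<in> U. \<not> b x z}"
    by (rule card_half[where t = y]) (use cl y xy in auto)
  also have "card {z \<in> U. \<not> b x z} = 2 * card {z \<in> {z \<in> U. \<not> b x z}. \<not> b y z}"
    by (rule card_half[where t = x]) (use cl x yx in auto)
  also have "{z \<in> {z \<in> U. \<not> b x z}. \<not> b y z} = perp2 x y U" by (auto simp: perp2_def)
  finally show "card U = 4 * card (perp2 x y U)" by simp
qed

text \<open>If \<open>b x y\<close> and \<open>q y\<close> hold, then \<open>x + y\<close> has value
  0 + 1 + 1 = 0 and still pairs to 1 with \<open>x\<close>.\<close>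

lemma hyperbolic_partner:
  assumes U: "nondeg U" and "x \<in> U" "\<not> q x" "x \<noteq> 0"
  obtains y where "y \<in> U" "\<not> q y" "b x y"
proof -
  obtain y where y: "y \<in> U" "b x y" using assms by (auto simp: nondeg_def)
  show thesis
  proof (cases "q y")
    case True
    have "x + y \<in> U" using U assms y by (auto simp: nondeg_def add_closed_def)
    then show thesis using that[of "x + y"] True y assms by auto
  next
    case False
    then show thesis using that y by blast
  qed
qed

text \<open>If \<open>q\<close> were 1 on all non-zero combinations of independent \<open>x\<close>,
  \<open>y\<close>, \<open>z\<close>, the three polar values would be 1 too, and the value at
  \<open>x + y + z\<close> would be a sum of six ones, which is 0.\<close>

lemma singular_exists:
  assumes U: "add_closed U" and card: "8 \<le> card U"
  shows "\<exists>x\<in>U. x \<noteq> 0 \<and> \<not> q x"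
proof -
  have ex: "\<exists>x\<in>U. x \<notin> S" if "card S < 8" for S :: "'v set"
    using that card card_mono[of S U] by fastforce
  obtain x where x: "x \<in> U" "x \<noteq> 0" using ex[of "{0}"] by auto
  obtain y where y: "y \<in> U" "y \<noteq> 0" "y \<noteq> x" using ex[of "{0, x}"] x by auto
  have "card {0, x, y, x + y} \<le> 4" by (simp add: card_insert_if)
  then obtain z where z: "z \<in> U" "z \<noteq> 0" "z \<noteq> x" "z \<noteq> y" "z \<noteq> x + y"
    using ex[of "{0, x, y, x + y}"] by auto
  have cl: "x + y \<in> U" "x + z \<in> U" "y + z \<in> U" "x + y + z \<in> U"
    using U x y z by (auto simp: add_closed_def)
  show ?thesis
  proof (rule ccontr)
    assume "\<not> ?thesis"
    then have all: "q w" if "w \<in> U" "w \<noteq> 0" for w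
      using that by blast
    have "x + y \<noteq> 0" "x + z \<noteq> 0" "y + z \<noteq> 0"
      using y z unfolding add_eq_0 by blast+
    then have "q x" "q y" "q z" "q (x + y)" "q (x + z)" "q (y + z)"
      using all x y z cl by blast+
    moreover have "x + y + z \<noteq> 0" using z unfolding add_eq_0 by blast
    then have "q (x + y + z)" by (rule all[OF cl(4)])
    ultimately show False by simp
  qed
qed

lemma translate_disjoint:
  fixes W :: "'v set"
  assumes "add_closed W" "z \<notin> W"
  shows "W \<inter> (+) z ` W = {}"
proof -
  have "False" if "w \<in> W" "z + w \<in> W" for w
  proof -
    have "w + (z + w) \<in> W" using assms that by (auto simp: add_closed_def)
    moreover have "w + (z + w) = z" by (simp only: add.commute[of z] double_left)
    ultimately show False using assms by simp
  qed
  then show ?thesis by auto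
qed

lemma sum_translate:
  fixes g :: "'v \<Rightarrow> nat" and W :: "'v set"
  assumes "add_closed W" "z \<notin> W"
  shows "sum g (W \<union> (+) z ` W) = (\<Sum>w\<in>W. g w + g (z + w))"
proof -
  have "sum g (W \<union> (+) z ` W) = sum g W + sum g ((+) z ` W)"
    by (rule sum.union_disjoint) (use translate_disjoint[OF assms] in auto)
  also have "sum g ((+) z ` W) = (\<Sum>w\<in>W. g (z + w))"
    by (subst sum.reindex) (auto simp: inj_on_def)
  finally show ?thesis by (simp add: sum.distrib)
qed

text \<open>The union is the span of \<open>W\<close> and \<open>z\<close>; the value at
  \<open>z + w\<close> is the sum of the values \<open>q z\<close>, \<open>q w\<close> and
  \<open>b z w\<close>, all 0.\<close>

lemma tot_sing_translate:
  assumes W: "tot_sing q W" and z: "\<not> q z" "\<And>w. w \<in> W \<Longrightarrow> \<not> b z w" "z \<notin> W"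
  shows "tot_sing q (W \<union> (+) z ` W)" "card (W \<union> (+) z ` W) = 2 * card W"
proof -
  have cl: "0 \<in> W" "\<And>v w. v \<in> W \<Longrightarrow> w \<in> W \<Longrightarrow> v + w \<in> W" and ns: "\<And>w. w \<in> W \<Longrightarrow> \<not> q w"
    using W by (auto simp: tot_sing_def add_closed_def)
  have "add_closed (W \<union> (+) z ` W)"
    unfolding add_closed_def
  proof (intro conjI ballI)
    fix r s assume "r \<in> W \<union> (+) z ` W" "s \<in> W \<union> (+) z ` W"
    then obtain r' s' where "r' \<in> W" "s' \<in> W" "r = r' \<or> r = z + r'" "s = s' \<or> s = z + s'"
      by blast
    moreover have "z + r' + s' = z + (r' + s')" "r' + (z + s') = z + (r' + s')"
      "z + r' + (z + s') = r' + s'"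
      by (simp_all only: add.assoc add.left_commute[of r' z] double_left)
    ultimately show "r + s \<in> W \<union> (+) z ` W"
      using cl(2)[of r' s'] by (elim disjE) (simp_all only: UnI1 UnI2 imageI)
  qed (use cl in simp)
  then show "tot_sing q (W \<union> (+) z ` W)"
    using ns z by (auto simp: tot_sing_def)
  have "add_closed W" using W by (simp add: tot_sing_def)
  then show "card (W \<union> (+) z ` W) = 2 * card W"
    using sum_translate[of W z "\<lambda>_. 1"] z by simp
qed

lemma tot_sing_two: "\<not> q x \<Longrightarrow> tot_sing q {0, x}"
  by (auto simp: tot_sing_def add_closed_def)

end

text \<open>Three mutually orthogonal hyperbolic pairs \<open>x\<close>, \<open>t\<close> and
  \<open>v\<close>, \<open>u\<close> and \<open>e\<close>, \<open>f\<close>, and orthogonal to them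
  a basis \<open>a\<close>, \<open>c\<close> of an anisotropic plane.\<close>

locale elliptic_frame = elliptic_space +
  fixes x t v u e f a c
  assumes frame_q: "\<not> q x" "\<not> q t" "\<not> q v" "\<not> q u" "\<not> q e" "\<not> q f" "q a" "q c"
    and frame_hyp: "b x t" "b v u" "b e f" "b a c"
    and frame_orth:
      "\<not> b x v" "\<not> b x u" "\<not> b x e" "\<not> b x f" "\<not> b x a" "\<not> b x c"
      "\<not> b t v" "\<not> b t u" "\<not> b t e" "\<not> b t f" "\<not> b t a" "\<not> b t c"
      "\<not> b v e" "\<not> b v f" "\<not> b v a" "\<not> b v c"
      "\<not> b u e" "\<not> b u f" "\<not> b u a" "\<not> b u c"
      "\<not> b e a" "\<not> b e c" "\<not> b f a" "\<not> b f c"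
begin

lemmas frame [simp] = frame_q frame_hyp frame_hyp[THEN b_commute[THEN iffD1]]
  frame_orth frame_orth[THEN not_b_commute]

end

context elliptic_space begin

text \<open>Split off \<open>v\<close>, \<open>u\<close>, then \<open>x\<close> with a partner, then
  a hyperbolic pair found among the remaining 16 vectors. The 4 vectors left form an anisotropic
  plane, by the bound on totally singular subspaces.\<close>

lemma frame_exists:
  assumes sing: "\<not> q x" "\<not> q v" "\<not> q u" and "x \<noteq> 0" "\<not> b x v" "\<not> b x u" and vu: "b v u"
  shows "\<exists>t e f a c. elliptic_frame q b x t v u e f a c"
proof -
  define U1 where "U1 = perp2 v u UNIV"
  have U1: "nondeg U1" "card U1 = 64"
    using nondeg_perp2[OF nondeg_UNIV UNIV_I UNIV_I vu] card_space by (auto simp: U1_def)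
  have "x \<in> U1" using assms not_b_commute by (auto simp: U1_def perp2_def)
  then obtain t where t: "t \<in> U1" "\<not> q t" "b x t"
    using hyperbolic_partner[OF U1(1)] assms by blast
  define U2 where "U2 = perp2 x t U1"
  have U2: "nondeg U2" "card U2 = 16"
    using nondeg_perp2[OF U1(1) \<open>x \<in> U1\<close> t(1,3)] U1 by (auto simp: U2_def)
  have "add_closed U2" using U2 by (simp add: nondeg_def)
  then obtain e where e: "e \<in> U2" "e \<noteq> 0" "\<not> q e"
    using singular_exists[of U2] U2 by auto
  obtain f where f: "f \<in> U2" "\<not> q f" "b e f"
    using hyperbolic_partner[OF U2(1) e(1,3,2)] by blast
  define U3 where "U3 = perp2 e f U2"
  have U3: "nondeg U3" "card U3 = 4"
    using nondeg_perp2[OF U2(1) e(1) f(1,3)] U2 by (auto simp: U3_def)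
  have perp: "\<not> b v z" "\<not> b u z" "\<not> b x z" "\<not> b t z" "\<not> b e z" "\<not> b f z" if "z \<in> U3" for z
    using that by (auto simp: U1_def U2_def U3_def perp2_def)
  have perp': "\<not> b v t" "\<not> b u t" "\<not> b v e" "\<not> b u e" "\<not> b x e" "\<not> b t e"
    "\<not> b v f" "\<not> b u f" "\<not> b x f" "\<not> b t f"
    using t(1) e(1) f(1) by (auto simp: U1_def U2_def perp2_def)
  have q3: "q z" if z: "z \<in> U3" "z \<noteq> 0" for z
  proof (rule ccontr)
    assume "\<not> q z"
    \<comment> \<open>Adjoin \<open>e\<close>, \<open>x\<close> and \<open>v\<close> in turn to
      \<open>z\<close>; pairing with the partners \<open>f\<close>, \<open>t\<close>,
      \<open>u\<close> shows that the new vector lies outside the span so far. The result has 16 > 8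
      elements.\<close>
    define W1 where "W1 = {0, z}"
    define W2 where "W2 = W1 \<union> (+) e ` W1"
    define W3 where "W3 = W2 \<union> (+) x ` W2"
    define W4 where "W4 = W3 \<union> (+) v ` W3"
    have W1: "tot_sing q W1" "card W1 = 2" using \<open>\<not> q z\<close> z tot_sing_two by (auto simp: W1_def)
    have "\<not> b e w" "\<not> b f w" if "w \<in> W1" for w
      using that perp[OF z(1)] by (auto simp: W1_def)
    moreover have "b f e" using f b_commute by blast
    ultimately have W2: "tot_sing q W2" "card W2 = 4"
      using tot_sing_translate[OF W1(1) e(3)] W1(2) by (auto simp: W2_def)
    have "\<not> b x w" "\<not> b t w" if "w \<in> W2" for w
      using that perp[OF z(1)] perp' by (auto simp: W1_def W2_def)
    moreover have "b t x" using t b_commute by blast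
    ultimately have W3: "tot_sing q W3" "card W3 = 8"
      using tot_sing_translate[OF W2(1) sing(1)] W2(2) by (auto simp: W3_def)
    have "\<not> b v w" "\<not> b u w" if "w \<in> W3" for w
      using that perp[OF z(1)] perp' assms not_b_commute by (auto simp: W1_def W2_def W3_def)
    moreover have "b u v" using vu b_commute by blast
    ultimately have W4: "tot_sing q W4" "card W4 = 16"
      using tot_sing_translate[OF W3(1) sing(2)] W3(2) by (auto simp: W4_def)
    then show False using tot_sing_card_le by fastforce
  qed
  have "\<not> U3 \<subseteq> {0}" using U3(2) card_mono[of "{0}" U3] by auto
  then obtain a where a: "a \<in> U3" "a \<noteq> 0" by blast
  have "\<not> U3 \<subseteq> {0, a}" using U3(2) card_mono[of "{0, a}" U3] a by auto
  then obtain c where c: "c \<in> U3" "c \<noteq> 0" "c \<noteq> a" by blast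
  have "a + c \<in> U3" using U3(1) a c by (auto simp: nondeg_def add_closed_def)
  then have "q (a + c)" using q3 c by (metis add_eq_0)
  then have "b a c" using q3[OF a] q3[OF c(1,2)] by simp
  have "elliptic_frame q b x t v u e f a c"
    by unfold_locales
      (use assms t e f a c q3 \<open>b a c\<close> perp[OF a(1)] perp[OF c(1)] perp' not_b_commute in blast)+
  then show ?thesis by blast
qed

end

section \<open>The quadrangle at a singular point\<close>

context elliptic_space begin

definition singular :: "'v set" where
  "singular = {z. z \<noteq> 0 \<and> \<not> q z}"

definition sing_perp :: "'v \<Rightarrow> 'v set" where
  "sing_perp x = {z. \<not> q z \<and> \<not> b x z \<and> z \<noteq> 0 \<and> z \<noteq> x}"

text \<open>The vectors \<open>z\<close> and \<open>x + z\<close> represent the same point of the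
  quadrangle, hence the condition \<open>p + r \<noteq> x\<close> beside
  \<open>p \<noteq> r\<close>.\<close>

definition line_sum :: "'v \<Rightarrow> nat \<Rightarrow> ('v \<Rightarrow> nat) \<Rightarrow> bool" where
  "line_sum x s w \<longleftrightarrow> (\<forall>p\<in>sing_perp x. \<forall>r\<in>sing_perp x.
     \<not> b p r \<longrightarrow> p \<noteq> r \<longrightarrow> p + r \<noteq> x \<longrightarrow> w p + w r + w (p + r) = s)"

lemma line_sumD:
  assumes "line_sum x s w" "p \<in> sing_perp x" "r \<in> sing_perp x" "\<not> b p r" "p \<noteq> r" "p + r \<noteq> x"
  shows "w p + w r + w (p + r) = s"
  using assms by (auto simp: line_sum_def)

end

context elliptic_frame begin

lemma frame_no_two_full:
  assumes w: "line_sum x s w" and full: "w v = s" "w u = s" and s: "0 < s"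
  shows False
proof -
  have neq: "r \<noteq> s" if "b u r" "\<not> b u s" for r s using that by blast
  have neq': "r \<noteq> s" if "b v r" "\<not> b v s" for r s using that by blast
  \<comment> \<open>Pairwise non-orthogonal singular vectors; their sum \<open>e + f + a + c\<close> is singular too.\<close>
  define S where "S = {e, f, e + f + a, e + f + c}"
  have S: "\<not> q z" "\<not> b x z" "\<not> b v z" "\<not> b u z" "\<not> b z v" "\<not> b z u" "z \<noteq> 0" "z \<noteq> x"
    if "z \<in> S" for z
  proof -
    have "b e z \<or> b f z" using that by (auto simp: S_def)
    then show "z \<noteq> 0" "z \<noteq> x" by auto
  qed (use that in \<open>auto simp: S_def\<close>)
  have v: "v \<in> sing_perp x" using neq[of v 0] neq[of v x] by (auto simp: sing_perp_def)
  have u: "u \<in> sing_perp x" using neq'[of u 0] neq'[of u x] by (auto simp: sing_perp_def)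
  \<comment> \<open>The line through \<open>v\<close> and \<open>z\<close> already has its whole
    total \<open>s\<close> at \<open>v\<close>.\<close>
  have vz: "w (v + z) = 0" "v + z \<in> sing_perp x" if "z \<in> S" for z
  proof -
    have "w v + w z + w (v + z) = s"
      by (rule line_sumD[OF w v])
        (use S[OF that] neq[of v z] neq[of "v + z" x] in \<open>auto simp: sing_perp_def\<close>)
    then show "w (v + z) = 0" using full by simp
    show "v + z \<in> sing_perp x"
      using S[OF that] neq[of "v + z" x] neq[of "v + z" 0] by (auto simp: sing_perp_def)
  qed
  have uz: "w (u + z) = 0" "u + z \<in> sing_perp x" if "z \<in> S" for z
  proof -
    have "w u + w z + w (u + z) = s"
      by (rule line_sumD[OF w u])
        (use S[OF that] neq'[of u z] neq'[of "u + z" x] in \<open>auto simp: sing_perp_def\<close>)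
    then show "w (u + z) = 0" using full by simp
    show "u + z \<in> sing_perp x"
      using S[OF that] neq'[of "u + z" x] neq'[of "u + z" 0] by (auto simp: sing_perp_def)
  qed
  \<comment> \<open>\<open>v + y\<close> and \<open>u + z\<close> are orthogonal because
    \<open>b v u\<close> and \<open>b y z\<close> cancel. Both have weight 0, so the third point of
    their line has weight \<open>s\<close>.\<close>
  have d: "w (v + y + (u + z)) = s" "v + y + (u + z) \<in> sing_perp x"
    if "y \<in> S" "z \<in> S" "b y z" for y z
  proof -
    have "w (v + y) + w (u + z) + w (v + y + (u + z)) = s"
      by (rule line_sumD[OF w vz(2) uz(2)])
        (use that S[of y] S[of z] neq[of "v + y" "u + z"] neq[of "v + y + (u + z)" x] in auto)
    then show "w (v + y + (u + z)) = s" using vz uz that by simp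
    show "v + y + (u + z) \<in> sing_perp x"
      using that S[of y] S[of z] neq[of "v + y + (u + z)" 0] neq[of "v + y + (u + z)" x]
      by (auto simp: sing_perp_def)
  qed
  \<comment> \<open>These are \<open>v + u + e + f\<close> and \<open>v + u + a + c\<close>:
    orthogonal, so two points of weight \<open>s\<close> on one line.\<close>
  let ?d1 = "v + e + (u + f)" and ?d2 = "v + (e + f + a) + (u + (e + f + c))"
  have d1: "w ?d1 = s" "?d1 \<in> sing_perp x" by (rule d; simp add: S_def)+
  have d2: "w ?d2 = s" "?d2 \<in> sing_perp x" by (rule d; simp add: S_def)+
  have "w ?d1 + w ?d2 + w (?d1 + ?d2) = s"
  proof (rule line_sumD[OF w d1(2) d2(2)])
    show "\<not> b ?d1 ?d2" by simp
    show "?d1 \<noteq> ?d2" by (rule neq_by_b[of e]) simp_all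
    show "?d1 + ?d2 \<noteq> x" by (rule neq_by_b[of e]) simp_all
  qed
  then show False using d1(1) d2(1) s by simp
qed

end

context elliptic_space begin

lemma no_two_full:
  assumes x: "x \<in> singular" and w: "line_sum x s w" "0 < s"
    and "v \<in> sing_perp x" "u \<in> sing_perp x" "w v = s" "w u = s"
  shows "\<not> b v u"
proof
  assume "b v u"
  then obtain t e f a c where "elliptic_frame q b x t v u e f a c"
    using frame_exists[of x v u] assms by (auto simp: sing_perp_def singular_def)
  then interpret elliptic_frame q b x t v u e f a c .
  show False by (rule frame_no_two_full[OF w(1) assms(6,7) w(2)])
qed

text \<open>If every vector orthogonal to \<open>x\<close> were orthogonal to \<open>v\<close>, the
  non-zero functionals \<open>b x\<close> and \<open>b v\<close> would coincide, and the singular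
  vector \<open>x + v\<close> would lie in the radical.\<close>

lemma perp_partner:
  assumes x: "x \<in> singular" and v: "v \<in> sing_perp x"
  obtains u where "\<not> q u" "\<not> b x u" "b v u"
proof -
  have "\<exists>y. \<not> b x y \<and> b v y"
  proof (rule ccontr)
    assume no: "\<not> ?thesis"
    obtain y where y: "b x y" using x nondegenerate_b by (auto simp: singular_def)
    obtain y' where y': "b v y'" using v nondegenerate_b by (auto simp: sing_perp_def)
    have bx: "b v y \<longleftrightarrow> b x y" for y
    proof -
      have "b x z" if "b v z" for z using no that by blast
      moreover have "b v z" if "b x z" for z
      proof (rule ccontr)
        assume "\<not> b v z"
        then have "b v (z + y')" using y' by simp
        moreover have "\<not> b x (z + y')" using that no y' by auto
        ultimately show False using no by blast
      qed
      ultimately show ?thesis by blast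
    qed
    have "x + v = 0"
      by (rule nondegenerate_b) (use x v bx in \<open>auto simp: singular_def sing_perp_def\<close>)
    then show False using v by (auto simp: sing_perp_def)
  qed
  then obtain y where y: "\<not> b x y" "b v y" by blast
  \<comment> \<open>If \<open>q y\<close> holds, \<open>v + y\<close> is singular and has the same
    pairings with \<open>x\<close> and \<open>v\<close>.\<close>
  show thesis
    by (cases "q y") (use y v that[of y] that[of "v + y"] in \<open>auto simp: sing_perp_def\<close>)
qed

lemma frame_at:
  assumes x: "x \<in> singular"
  obtains t v u e f a c where "elliptic_frame q b x t v u e f a c"
proof -
  obtain t where t: "\<not> q t" "b x t"
    using hyperbolic_partner[OF nondeg_UNIV, of x] x by (auto simp: singular_def)
  have U: "nondeg (perp2 x t UNIV)" "card (perp2 x t UNIV) = 64"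
    using nondeg_perp2[OF nondeg_UNIV UNIV_I UNIV_I t(2)] card_space by auto
  then obtain v where v: "v \<in> perp2 x t UNIV" "v \<noteq> 0" "\<not> q v"
    using singular_exists[of "perp2 x t UNIV"] by (auto simp: nondeg_def)
  have "v \<in> sing_perp x" using v t b_commute by (auto simp: sing_perp_def perp2_def)
  then obtain u where "\<not> q u" "\<not> b x u" "b v u"
    using perp_partner[OF x] by blast
  moreover have "x \<noteq> 0" "\<not> q x" "\<not> b x v" using x v by (auto simp: singular_def perp2_def)
  ultimately show thesis
    using frame_exists[of x v u] v that by blast
qed

text \<open>In a frame, the line on \<open>u\<close>, \<open>e\<close> and \<open>u + e\<close>
  avoids the quadrangle point of \<open>v\<close>, and its total 1 yields a point of weight 1 on
  it.\<close>

lemma sing_line_value: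
  assumes x: "x \<in> singular" and w: "line_sum x (Suc 0) w"
    and v: "v \<in> sing_perp x" and u: "\<not> q u" "\<not> b x u" "b v u"
  obtains r where "r \<in> sing_perp x" "w r = 1" "r \<noteq> v" "r + v \<noteq> x"
proof -
  obtain t e f a c where "elliptic_frame q b x t v u e f a c"
    using frame_exists[of x v u] x v u by (auto simp: sing_perp_def singular_def)
  then interpret elliptic_frame q b x t v u e f a c .
  have u: "u \<in> sing_perp x" using neq_by_b[of v u 0] neq_by_b[of v u x] by (auto simp: sing_perp_def)
  have e: "e \<in> sing_perp x" using neq_by_b[of f e 0] neq_by_b[of f e x] by (auto simp: sing_perp_def)
  have ue: "u + e \<in> sing_perp x"
    using neq_by_b[of f "u + e" 0] neq_by_b[of f "u + e" x] by (auto simp: sing_perp_def)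
  have "w u + w e + w (u + e) = Suc 0"
    by (rule line_sumD[OF w u e])
      (use neq_by_b[of v u e] neq_by_b[of v "u + e" x] in auto)
  then consider "w u = 1" | "w e = 1" | "w (u + e) = 1" by linarith
  then show thesis
  proof cases
    case 1
    then show thesis
      by (intro that[of u]) (use u neq_by_b[of v u v] neq_by_b[of v "u + v" x] in auto)
  next
    case 2
    then show thesis
      by (intro that[of e]) (use e neq_by_b[of f e v] neq_by_b[of f "e + v" x] in auto)
  next
    case 3
    then show thesis
      by (intro that[of "u + e"])
        (use ue neq_by_b[of v "u + e" v] neq_by_b[of v "u + e + v" x] in auto)
  qed
qed

text \<open>\<open>sing_line_value\<close> gives one point of weight 1 and then a second one. They
  are orthogonal by \<open>no_two_full\<close>, so they lie on a common line with total at least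
  2.\<close>

lemma no_unit_line_sum:
  assumes x: "x \<in> singular" and w: "line_sum x (Suc 0) w"
  shows False
proof -
  obtain t v u e f a c where "elliptic_frame q b x t v u e f a c"
    using frame_at[OF x] .
  then interpret elliptic_frame q b x t v u e f a c .
  have "v \<in> sing_perp x" using neq_by_b[of u v 0] neq_by_b[of u v x] by (auto simp: sing_perp_def)
  then obtain p where p: "p \<in> sing_perp x" "w p = 1"
    using sing_line_value[OF x w, of v u] by auto
  obtain u' where "\<not> q u'" "\<not> b x u'" "b p u'"
    using perp_partner[OF x p(1)] .
  then obtain r where r: "r \<in> sing_perp x" "w r = 1" "r \<noteq> p" "r + p \<noteq> x"
    using sing_line_value[OF x w p(1)] by blast
  have "\<not> b p r" using no_two_full[OF x w _ p(1) r(1)] p r by simp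
  then have "w p + w r + w (p + r) = Suc 0"
    using line_sumD[OF w p(1) r(1)] r by (metis add.commute)
  then show False using p r by simp
qed

section \<open>Ovoids as weights on the quadrangle\<close>

definition ovoid_set :: "nat \<Rightarrow> 'v set \<Rightarrow> bool" where
  "ovoid_set m Y \<longleftrightarrow> Y \<subseteq> singular \<and> (\<forall>W. tot_sing q W \<longrightarrow> card W = 8 \<longrightarrow> card (Y \<inter> W) = m)"

definition line_weight :: "'v set \<Rightarrow> 'v \<Rightarrow> 'v \<Rightarrow> nat" where
  "line_weight Y x z = of_bool (z \<in> Y) + of_bool (x + z \<in> Y)"

lemma card_Int_sum: "card (Y \<inter> W) = (\<Sum>z\<in>W. of_bool (z \<in> Y))" for W :: "'v set"
  by (simp add: sum.If_cases of_bool_def Int_commute)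

text \<open>The seven non-zero vectors of the plane spanned by \<open>x\<close>, \<open>p\<close>,
  \<open>r\<close> are \<open>x\<close> and the pairs \<open>z\<close>, \<open>x + z\<close> for
  \<open>z\<close> equal to \<open>p\<close>, \<open>r\<close> and \<open>p + r\<close>.\<close>

lemma line_weight_sum:
  assumes Y: "ovoid_set m Y" and x: "x \<in> singular"
    and p: "p \<in> sing_perp x" and r: "r \<in> sing_perp x" and pr: "\<not> b p r" "p \<noteq> r" "p + r \<noteq> x"
  shows "of_bool (x \<in> Y) + line_weight Y x p + line_weight Y x r + line_weight Y x (p + r) = m"
proof -
  define W2 where "W2 = {0, x} \<union> (+) p ` {0, x}"
  define W3 where "W3 = W2 \<union> (+) r ` W2"
  have x': "x \<noteq> 0" "\<not> q x" using x by (auto simp: singular_def)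
  have bp: "\<not> b p x" "\<not> b r x" "\<not> b r p" using p r pr not_b_commute by (auto simp: sing_perp_def)
  have pn: "p \<notin> {0, x}" using p by (auto simp: sing_perp_def)
  have "\<not> q p" "\<And>z. z \<in> {0, x} \<Longrightarrow> \<not> b p z" using p bp by (auto simp: sing_perp_def)
  note tot_sing_translate[OF tot_sing_two[OF x'(2)] this pn, folded W2_def]
  then have W2: "tot_sing q W2" "card W2 = 4" using x' by auto
  have rn: "r \<notin> W2" using r pr by (auto simp: W2_def sing_perp_def)
  have "\<not> b r z" if "z \<in> W2" for z using that bp by (auto simp: W2_def)
  then have W3: "tot_sing q W3" "card W3 = 8"
    using tot_sing_translate[OF W2(1) _ _ rn] r W2(2) by (auto simp: W3_def sing_perp_def)
  have "0 \<notin> Y" using Y by (auto simp: ovoid_set_def singular_def)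
  have "m = card (Y \<inter> W3)" using Y W3 by (auto simp: ovoid_set_def)
  also have "\<dots> = (\<Sum>z\<in>W2. of_bool (z \<in> Y) + of_bool (r + z \<in> Y))"
    unfolding card_Int_sum W3_def
    by (rule sum_translate) (use W2 rn in \<open>auto simp: tot_sing_def\<close>)
  also have "\<dots> = (\<Sum>z\<in>{0, x}. (of_bool (z \<in> Y) + of_bool (r + z \<in> Y)) +
      (of_bool (p + z \<in> Y) + of_bool (r + (p + z) \<in> Y)))"
    unfolding W2_def
    by (rule sum_translate) (use tot_sing_two[OF x'(2)] pn in \<open>auto simp: tot_sing_def\<close>)
  also have "\<dots> = of_bool (x \<in> Y) + line_weight Y x p + line_weight Y x r + line_weight Y x (p + r)"
    using x' \<open>0 \<notin> Y\<close> by (simp add: line_weight_def add.commute add.left_commute)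
  finally show ?thesis by simp
qed

lemma ovoid_line_sum:
  assumes "ovoid_set m Y" "x \<in> singular"
  shows "line_sum x (m - of_bool (x \<in> Y)) (line_weight Y x)"
  unfolding line_sum_def
proof (intro ballI impI)
  fix p r assume "p \<in> sing_perp x" "r \<in> sing_perp x" "\<not> b p r" "p \<noteq> r" "p + r \<noteq> x"
  from line_weight_sum[OF assms this]
  show "line_weight Y x p + line_weight Y x r + line_weight Y x (p + r) = m - of_bool (x \<in> Y)"
    by linarith
qed

text \<open>A singular vector outside \<open>Y\<close> would give line totals 1. Thus
  \<open>Y\<close> is trivial, which is the form in which the case is excluded later.\<close>

lemma no_1_ovoid:
  assumes Y: "ovoid_set (Suc 0) Y"
  shows "singular \<subseteq> Y"
proof
  fix x assume x: "x \<in> singular"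
  show "x \<in> Y"
    using ovoid_line_sum[OF Y x] no_unit_line_sum[OF x] by (cases "x \<in> Y") auto
qed

lemma no_2_ovoid:
  assumes Y: "ovoid_set 2 Y"
  shows "Y = {}"
proof (rule equals0I)
  fix x assume "x \<in> Y"
  moreover from this have "x \<in> singular" using Y by (auto simp: ovoid_set_def)
  ultimately show False using ovoid_line_sum[OF Y] no_unit_line_sum by fastforce
qed

text \<open>Seen from \<open>x\<close> the line totals are 2, and a line inside \<open>Y\<close> is
  a quadrangle point of weight 2. Two such points would be orthogonal, hence on a common line of
  total at least 4.\<close>

lemma ovoid_3_line:
  assumes Y: "ovoid_set 3 Y" and x: "x \<in> Y"
  obtains p where "p \<in> Y" "x + p \<in> Y"
    "\<And>r. r \<in> Y \<Longrightarrow> x + r \<in> Y \<Longrightarrow> r = p \<or> r = x + p"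
proof -
  define w where "w = line_weight Y x"
  have xs: "x \<in> singular" using Y x by (auto simp: ovoid_set_def)
  have w: "line_sum x 2 w" using ovoid_line_sum[OF Y xs] x by (simp add: w_def)
  have full: "w r = 2 \<longleftrightarrow> r \<in> Y \<and> x + r \<in> Y" for r by (auto simp: w_def line_weight_def)
  have "\<exists>p\<in>sing_perp x. w p = 2"
  proof (rule ccontr)
    assume no: "\<not> ?thesis"
    have le: "w r \<le> 1" if "r \<in> sing_perp x" for r
    proof -
      have "w r \<le> 2" by (auto simp: w_def line_weight_def)
      then show ?thesis using no that by (metis le_SucE numeral_2_eq_2 One_nat_def)
    qed
    \<comment> \<open>If all weights are at most 1, their complements have total 3 - 2 = 1 on every
      line.\<close>
    have "line_sum x (Suc 0) (\<lambda>r. 1 - w r)"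
      unfolding line_sum_def
    proof (intro ballI impI)
      fix p r assume pr: "p \<in> sing_perp x" "r \<in> sing_perp x" "\<not> b p r" "p \<noteq> r" "p + r \<noteq> x"
      then have "p + r \<in> sing_perp x" by (auto simp: sing_perp_def)
      then show "1 - w p + (1 - w r) + (1 - w (p + r)) = Suc 0"
        using line_sumD[OF w pr] le[of p] le[of r] le[of "p + r"] pr by linarith
    qed
    then show False using no_unit_line_sum[OF xs] by blast
  qed
  then obtain p where p: "p \<in> sing_perp x" "w p = 2" by blast
  have "r = p \<or> r = x + p" if r: "r \<in> Y" "x + r \<in> Y" for r
  proof (rule ccontr)
    assume ne: "\<not> ?thesis"
    have "r \<in> singular" "x + r \<in> singular" using r Y by (auto simp: ovoid_set_def)
    then have rp: "r \<in> sing_perp x" using xs by (auto simp: singular_def sing_perp_def)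
    have "\<not> b p r" using no_two_full[OF xs w _ p(1) rp] p r full by simp
    moreover have "p + r \<noteq> x"
    proof
      assume "p + r = x"
      then have "r = x + p" by (metis add.commute double_left)
      then show False using ne by blast
    qed
    ultimately have "w p + w r + w (p + r) = 2"
      using line_sumD[OF w p(1) rp] ne by blast
    then show False using p r full[of r] by simp
  qed
  then show thesis using that p full by blast
qed

end

section \<open>Coordinates, spread and ovoid\<close>

type_synonym octet = "bool \<times> bool \<times> bool \<times> bool \<times> bool \<times> bool \<times> bool \<times> bool"

definition oct_zero :: octet where
  "oct_zero = (False, False, False, False, False, False, False, False)"

definition oct_add :: "octet \<Rightarrow> octet \<Rightarrow> octet" where
  "oct_add = (\<lambda>(a,b,c,d,e,f,g,h) (a',b',c',d',e',f',g',h').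
     (a \<noteq> a', b \<noteq> b', c \<noteq> c', d \<noteq> d', e \<noteq> e', f \<noteq> f', g \<noteq> g', h \<noteq> h'))"

text \<open>Over the field with two elements \<open>g \<or> h\<close> is the anisotropic form g^2 +
  gh + h^2, so the shape is that of a frame.\<close>

definition oct_form :: "octet \<Rightarrow> bool" where
  "oct_form = (\<lambda>(a,b,c,d,e,f,g,h). ((a \<and> b) \<noteq> (c \<and> d)) \<noteq> ((e \<and> f) \<noteq> (g \<or> h)))"

definition oct_polar :: "octet \<Rightarrow> octet \<Rightarrow> bool" where
  "oct_polar x y \<longleftrightarrow> oct_form (oct_add x y) \<noteq> (oct_form x \<noteq> oct_form y)"

text \<open>In the model \<open>Q x = Tr (x\<^bsup>17\<^esup>)\<close> on the field with \<open>256\<close> elements (trace from 16 to 2 elements)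
  and suitable standard coordinates, this is multiplication by an element of order \<open>17\<close>.  The lists
  below are the non-zero elements of the subfield with \<open>4\<close> elements and of the kernel of the trace on
  the subfield with \<open>16\<close> elements; the orbit of the former is the group of order \<open>51\<close>.\<close>

definition oct_rot :: "octet \<Rightarrow> octet" where
  "oct_rot = (\<lambda>(a,b,c,d,e,f,g,h).
     (e, (b \<noteq> c) \<noteq> f, b, (a \<noteq> c) \<noteq> (d \<noteq> g), b \<noteq> c, (b \<noteq> d) \<noteq> e, b \<noteq> h, g))"

primrec orbit :: "nat \<Rightarrow> octet list \<Rightarrow> octet list list" where
  "orbit 0 xs = []"
| "orbit (Suc n) xs = xs # orbit n (map oct_rot xs)"

definition oct_line :: "octet list" where
  "oct_line = [(True, False, False, False, False, False, False, False),
     (False, False, True, False, False, False, False, False),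
     (True, False, True, False, False, False, False, False)]"

definition oct_plane :: "octet list" where
  "oct_plane = (True, False, True, False, True, False, False, False) #
     (True, False, False, False, True, False, False, False) #
     (False, False, True, False, True, False, False, False) #
     (False, False, False, False, True, False, False, False) # oct_line"

definition oct_spread :: "octet list list" where
  "oct_spread = orbit 17 oct_plane"

definition oct_ovoid :: "octet list" where
  "oct_ovoid = concat (orbit 17 oct_line)"

definition oct_singular :: "octet list" where
  "oct_singular = filter (\<lambda>c. \<not> oct_form c \<and> c \<noteq> oct_zero) Enum.enum"

lemma oct_spread_plane:
  "\<forall>\<pi>\<in>set oct_spread. length \<pi> = 7 \<and>
     (\<forall>r\<in>set \<pi>. \<forall>s\<in>set \<pi>. r = s \<or> oct_add r s \<in> set \<pi>)"
  by code_simp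

lemma length_oct_spread: "length oct_spread = 17"
  by code_simp

lemma distinct_oct_spread: "distinct (concat oct_spread)"
  by code_simp

lemma oct_spread_singular: "\<forall>r\<in>set (concat oct_spread). r \<in> set oct_singular"
  by code_simp

text \<open>With \<open>distinct_oct_spread\<close> and \<open>oct_spread_singular\<close> this
  makes the 17 planes a partition of the 17 * 7 = 119 singular vectors.\<close>

lemma oct_singular_spread: "\<forall>r\<in>set oct_singular. r \<in> set (concat oct_spread)"
  by code_simp

text \<open>The values 27 = 3 * 9 and 19 = 27 - 8 are the intersection numbers of a 3-ovoid with
  perps of singular points; \<open>p\<close> itself is counted when it is in the list.\<close>

lemma oct_ovoid_section:
  "\<forall>p\<in>set oct_singular. length (filter (\<lambda>z. \<not> oct_polar p z) oct_ovoid) =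
     (if p \<in> set oct_ovoid then 19 else 27)"
  by code_simp

lemma oct_ovoid_singular: "\<forall>r\<in>set oct_ovoid. r \<in> set oct_singular"
  by code_simp

lemma distinct_oct_ovoid: "distinct oct_ovoid"
  by code_simp

lemma length_oct_ovoid: "length oct_ovoid = 51"
  by code_simp

lemma set_oct_singular: "set oct_singular = {r. \<not> oct_form r \<and> r \<noteq> oct_zero}"
  by (auto simp: oct_singular_def enum_UNIV)

lemma sum_list_map_concat:
  "sum_list (map g (concat xss)) = (\<Sum>xs\<leftarrow>xss. sum_list (map g xs))"
  by (induction xss) simp_all

lemma oct_cases:
  obtains c1 c2 c3 c4 c5 c6 c7 c8 where "(r :: octet) = (c1, c2, c3, c4, c5, c6, c7, c8)"
  by (cases r rule: prod_cases7) (metis surj_pair)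

section \<open>Coordinates with respect to a frame\<close>

context elliptic_frame begin

definition pick :: "bool \<Rightarrow> 'a \<Rightarrow> 'a" where
  "pick d z = (if d then z else 0)"

lemma pick [simp]:
  "q (pick d z) \<longleftrightarrow> d \<and> q z" "b (pick d z) y \<longleftrightarrow> d \<and> b z y" "b y (pick d z) \<longleftrightarrow> d \<and> b y z"
  "pick False z = 0"
  by (auto simp: pick_def)

lemma pick_add: "pick (d \<noteq> d') z = pick d z + pick d' z"
  by (auto simp: pick_def)

definition coord :: "octet \<Rightarrow> 'a" where
  "coord = (\<lambda>(c1,c2,c3,c4,c5,c6,c7,c8). pick c1 x + pick c2 t + pick c3 v + pick c4 u +
     pick c5 e + pick c6 f + pick c7 a + pick c8 c)"

text \<open>Each coordinate is read off by pairing with the partner of its frame vector, so the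
  members of each pair appear exchanged.\<close>

definition decode :: "'a \<Rightarrow> octet" where
  "decode z = (b t z, b x z, b u z, b v z, b f z, b e z, b c z, b a z)"

lemma coord_zero: "coord oct_zero = 0"
  by (simp add: coord_def oct_zero_def)

lemma coord_add: "coord (oct_add r s) = coord r + coord s"
  by (cases r rule: oct_cases; cases s rule: oct_cases) (simp add: coord_def oct_add_def pick_add ac_simps del: not_iff)

lemma q_coord: "q (coord r) \<longleftrightarrow> oct_form r"
  by (cases r rule: oct_cases) (simp add: coord_def oct_form_def, argo)

lemma b_coord: "b (coord r) (coord s) \<longleftrightarrow> oct_polar r s"
  using q_add[of "coord r" "coord s"] unfolding oct_polar_def coord_add[symmetric] q_coord by argo

lemma decode_coord: "decode (coord r) = r"
  by (cases r rule: oct_cases) (simp add: coord_def decode_def)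

lemma inj_coord: "inj coord"
  by (rule inj_on_inverseI) (rule decode_coord)

lemma surj_coord: "surj coord"
proof -
  have "CARD(octet) = 256" by simp
  then have "card (range coord) = CARD('a)"
    using card_image[OF inj_coord] card_space by simp
  then show ?thesis by (simp add: card_eq_UNIV_imp_eq_UNIV)
qed

lemma coord_eq_0: "coord r = 0 \<longleftrightarrow> r = oct_zero"
  using inj_coord coord_zero by (metis injD)

lemma singular_coord: "singular = coord ` set oct_singular"
proof (rule set_eqI)
  fix z
  obtain r where z: "z = coord r" using surj_coord by (rule surjE)
  have "coord r \<in> coord ` set oct_singular \<longleftrightarrow> r \<in> set oct_singular"
    by (rule inj_image_mem_iff[OF inj_coord])
  then show "z \<in> singular \<longleftrightarrow> z \<in> coord ` set oct_singular"
    unfolding z by (auto simp: singular_def set_oct_singular q_coord coord_eq_0)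
qed

lemma spread_plane:
  assumes "\<pi> \<in> set oct_spread"
  shows "tot_sing q (insert 0 (coord ` set \<pi>))" "card (insert 0 (coord ` set \<pi>)) = 8"
    "0 \<notin> coord ` set \<pi>"
proof -
  have "set \<pi> \<subseteq> set oct_singular" using oct_spread_singular assms by auto
  then have sing: "\<not> oct_form r" "r \<noteq> oct_zero" if "r \<in> set \<pi>" for r
    using that by (auto simp: set_oct_singular)
  have len: "length \<pi> = 7" and
    cl: "\<And>r s. r \<in> set \<pi> \<Longrightarrow> s \<in> set \<pi> \<Longrightarrow> r = s \<or> oct_add r s \<in> set \<pi>"
    using oct_spread_plane assms by auto
  show 0: "0 \<notin> coord ` set \<pi>" using sing coord_eq_0 by (metis imageE)
  have "distinct \<pi>" using distinct_oct_spread assms by (simp add: distinct_concat_iff)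
  then have "card (coord ` set \<pi>) = 7"
    using card_image[OF inj_on_subset[OF inj_coord subset_UNIV]] len by (simp add: distinct_card)
  then show "card (insert 0 (coord ` set \<pi>)) = 8" using 0 by simp
  have "coord r + coord s \<in> insert 0 (coord ` set \<pi>)" if "r \<in> set \<pi>" "s \<in> set \<pi>" for r s
    using cl[OF that]
  proof
    assume "oct_add r s \<in> set \<pi>"
    then show ?thesis using coord_add by (metis image_eqI insertI2)
  qed simp
  then show "tot_sing q (insert 0 (coord ` set \<pi>))"
    using sing by (auto simp: tot_sing_def add_closed_def q_coord)
qed

lemma singular_spread: "singular = coord ` set (concat oct_spread)"
  using oct_spread_singular oct_singular_spread unfolding singular_coord by blast

text \<open>The 17 spread planes partition the singular vectors, and each meets \<open>Y\<close> in
  \<open>m\<close> of them.\<close>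

lemma frame_ovoid_card:
  assumes Y: "ovoid_set m Y"
  shows "card Y = 17 * m"
proof -
  let ?g = "\<lambda>r. of_bool (coord r \<in> Y) :: nat"
  have plane: "sum_list (map ?g \<pi>) = m" if "\<pi> \<in> set oct_spread" for \<pi>
  proof -
    have "distinct \<pi>" using distinct_oct_spread that by (simp add: distinct_concat_iff)
    then have "sum_list (map ?g \<pi>) = (\<Sum>z\<in>coord ` set \<pi>. of_bool (z \<in> Y))"
      by (simp add: sum_list_distinct_conv_sum_set sum.reindex inj_on_subset[OF inj_coord] del: sum_of_bool_eq)
    also have "\<dots> = card (Y \<inter> coord ` set \<pi>)" by (rule card_Int_sum[symmetric])
    also have "Y \<inter> coord ` set \<pi> = Y \<inter> insert 0 (coord ` set \<pi>)"
      using Y by (auto simp: ovoid_set_def singular_def)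
    also have "card \<dots> = m" using Y spread_plane[OF that] by (simp add: ovoid_set_def)
    finally show ?thesis .
  qed
  have "Y = Y \<inter> coord ` set (concat oct_spread)"
    using Y singular_spread by (simp only: ovoid_set_def) blast
  then have "card Y = (\<Sum>z\<in>coord ` set (concat oct_spread). of_bool (z \<in> Y))"
    by (metis card_Int_sum)
  also have "\<dots> = sum_list (map ?g (concat oct_spread))"
    using distinct_oct_spread
    by (simp add: sum_list_distinct_conv_sum_set sum.reindex inj_on_subset[OF inj_coord] del: sum_of_bool_eq set_concat)
  also have "\<dots> = sum_list (map (\<lambda>\<pi>. sum_list (map ?g \<pi>)) oct_spread)"
    by (rule sum_list_map_concat)
  also have "\<dots> = sum_list (map (\<lambda>_. m) oct_spread)"
    by (rule arg_cong[where f = sum_list], rule map_cong) (use plane in auto)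
  also have "\<dots> = 17 * m" by (simp add: map_replicate_const length_oct_spread sum_list_replicate)
  finally show ?thesis .
qed

lemma tot_sing_b:
  assumes "tot_sing q W" "y \<in> W" "z \<in> W"
  shows "\<not> b y z"
proof -
  have "\<not> q (y + z)" "\<not> q y" "\<not> q z" using assms by (auto simp: tot_sing_def add_closed_def simp del: q_add)
  then show ?thesis by simp
qed

lemma frame_ovoid_exists: "ovoid_set 3 (coord ` set oct_ovoid)"
proof -
  define Y where "Y = coord ` set oct_ovoid"
  have inj: "inj_on coord S" for S by (rule inj_on_subset[OF inj_coord subset_UNIV])
  have card_Y: "card Y = 51"
    unfolding Y_def card_image[OF inj] using distinct_oct_ovoid length_oct_ovoid distinct_card by metis
  have Y_sub: "Y \<subseteq> singular"
    using oct_ovoid_singular unfolding Y_def singular_coord by blast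
  have perp_count: "card {z \<in> Y. \<not> b p z} + 8 * of_bool (p \<in> Y) = 27" if p: "p \<in> singular" for p
  proof -
    obtain r where r: "p = coord r" "r \<in> set oct_singular" using p unfolding singular_coord by (rule imageE)
    have "{z \<in> Y. \<not> b p z} = coord ` set (filter (\<lambda>z. \<not> oct_polar r z) oct_ovoid)"
      by (auto simp: Y_def r b_coord)
    then have "card {z \<in> Y. \<not> b p z} = length (filter (\<lambda>z. \<not> oct_polar r z) oct_ovoid)"
      using distinct_oct_ovoid by (simp add: card_image[OF inj] distinct_card del: set_filter)
    moreover have "p \<in> Y \<longleftrightarrow> r \<in> set oct_ovoid"
      unfolding Y_def r by (rule inj_image_mem_iff[OF inj_coord])
    ultimately show ?thesis using oct_ovoid_section r by auto
  qed
  have "card (Y \<inter> W) = 3" if W: "tot_sing q W" "card W = 8" for W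
  proof -
    have cl: "0 \<in> W" "add_closed W" using W by (auto simp: tot_sing_def add_closed_def)
    have W_sing: "p \<in> singular" if "p \<in> W - {0}" for p
      using that W by (auto simp: tot_sing_def singular_def)
    \<comment> \<open>A vector of \<open>Y\<close> in \<open>W\<close> is orthogonal to all 8
      vectors of \<open>W\<close>, any other one to exactly half of them.\<close>
    have sec: "card {p \<in> W. \<not> b z p} = 4 + 4 * of_bool (z \<in> W)" if "z \<in> Y" for z
    proof (cases "z \<in> W")
      case True
      then have "{p \<in> W. \<not> b z p} = W" using tot_sing_b[OF W(1)] by auto
      then show ?thesis using True W by simp
    next
      case False
      have "\<not> q z" using that Y_sub by (auto simp: singular_def)
      \<comment> \<open>Otherwise \<open>z\<close> would enlarge \<open>W\<close> to a totally
        singular subspace with 16 elements.\<close>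
      have "\<exists>p\<in>W. b z p"
      proof (rule ccontr)
        assume "\<not> ?thesis"
        then have "tot_sing q (W \<union> (+) z ` W)" "card (W \<union> (+) z ` W) = 16"
          using tot_sing_translate[OF W(1) \<open>\<not> q z\<close> _ False] W by auto
        then show False using tot_sing_card_le by fastforce
      qed
      then obtain p where "p \<in> W" "b z p" by blast
      then have "card W = 2 * card {p \<in> W. \<not> b z p}"
        by (intro card_half[where t = p]) (use cl in \<open>auto simp: add_closed_def\<close>)
      then show ?thesis using W False by simp
    qed
    have "(\<Sum>z\<in>Y. card {p \<in> W. \<not> b z p}) = (\<Sum>z\<in>Y. \<Sum>p\<in>W. of_bool (\<not> b z p))"
      by (intro sum.cong refl) (simp add: Collect_conj_eq)
    also have "\<dots> = (\<Sum>p\<in>W. \<Sum>z\<in>Y. of_bool (\<not> b p z))"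
      by (subst sum.swap) (simp only: b_commute)
    also have "\<dots> = (\<Sum>p\<in>W. card {z \<in> Y. \<not> b p z})"
      by (intro sum.cong refl) (simp add: Collect_conj_eq)
    also have "\<dots> = card {z \<in> Y. \<not> b 0 z} + (\<Sum>p\<in>W - {0}. card {z \<in> Y. \<not> b p z})"
      by (rule sum.remove) (use cl in auto)
    finally have count: "(\<Sum>z\<in>Y. card {p \<in> W. \<not> b z p}) =
      51 + (\<Sum>p\<in>W - {0}. card {z \<in> Y. \<not> b p z})" using card_Y by simp
    have "(\<Sum>z\<in>Y. card {p \<in> W. \<not> b z p}) = (\<Sum>z\<in>Y. 4 + 4 * of_bool (z \<in> W))"
      by (rule sum.cong) (use sec in auto)
    also have "\<dots> = 4 * card Y + 4 * card (W \<inter> Y)"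
      unfolding card_Int_sum[of W Y] sum.distrib sum_distrib_left by simp
    finally have 1: "(\<Sum>z\<in>Y. card {p \<in> W. \<not> b z p}) = 204 + 4 * card (Y \<inter> W)"
      using card_Y by (simp add: Int_commute)
    \<comment> \<open>Each of the 7 non-zero \<open>p\<close> contributes 27, less 8 when it lies in
      \<open>Y\<close>; 7 * 27 = 189.\<close>
    have "(\<Sum>p\<in>W - {0}. card {z \<in> Y. \<not> b p z}) + 8 * card (Y \<inter> (W - {0})) =
        (\<Sum>p\<in>W - {0}. card {z \<in> Y. \<not> b p z} + 8 * of_bool (p \<in> Y))"
      unfolding card_Int_sum sum.distrib sum_distrib_left by simp
    also have "\<dots> = (\<Sum>p\<in>W - {0}. 27)"
      by (rule sum.cong) (use perp_count W_sing in auto)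
    also have "\<dots> = 189" using cl W by simp
    also have "Y \<inter> (W - {0}) = Y \<inter> W" using Y_sub by (auto simp: singular_def)
    \<comment> \<open>With k common vectors the two counts give 204 + 4k = 51 + 189 - 8k, so k =
      3.\<close>
    finally show ?thesis using 1 count by linarith
  qed
  then show ?thesis using Y_sub by (auto simp: ovoid_set_def Y_def)
qed

end

section \<open>Ovoids and their lines\<close>

context elliptic_space begin

lemma singular_nonempty: "\<exists>x. x \<in> singular"
  using singular_exists[of UNIV] card_space by (auto simp: singular_def add_closed_def)

lemma ovoid_card:
  assumes "ovoid_set m Y"
  shows "card Y = 17 * m"
proof -
  obtain x where "x \<in> singular" using singular_nonempty by blast
  then obtain t v u e f a c where "elliptic_frame q b x t v u e f a c" by (rule frame_at)
  then interpret elliptic_frame q b x t v u e f a c .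
  show ?thesis by (rule frame_ovoid_card[OF assms])
qed

lemma ovoid_3_exists: "\<exists>Y. ovoid_set 3 Y"
proof -
  obtain x where "x \<in> singular" using singular_nonempty by blast
  then obtain t v u e f a c where "elliptic_frame q b x t v u e f a c" by (rule frame_at)
  then interpret elliptic_frame q b x t v u e f a c .
  show ?thesis using frame_ovoid_exists by blast
qed

lemma singular_in_plane:
  assumes "x \<in> singular"
  obtains W where "tot_sing q W" "card W = 8" "x \<in> W"
proof -
  obtain t v u e f a c where "elliptic_frame q b x t v u e f a c"
    using frame_at[OF assms] .
  then interpret elliptic_frame q b x t v u e f a c .
  obtain \<pi> r where "\<pi> \<in> set oct_spread" "r \<in> set \<pi>" "x = coord r"
    using assms unfolding singular_spread by auto
  then show thesis using spread_plane[of \<pi>] that by blast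
qed

lemma card_plane_singular:
  assumes "tot_sing q W" "card W = 8"
  shows "card (singular \<inter> W) = 7"
proof -
  have "singular \<inter> W = W - {0}" "0 \<in> W"
    using assms by (auto simp: singular_def tot_sing_def add_closed_def)
  then show ?thesis using assms by simp
qed

lemma ovoid_complement:
  assumes "ovoid_set m Y"
  shows "ovoid_set (7 - m) (singular - Y)"
  unfolding ovoid_set_def
proof (intro conjI allI impI)
  fix W :: "'v set" assume W: "tot_sing q W" "card W = 8"
  have "(singular - Y) \<inter> W = (singular \<inter> W) - (Y \<inter> W)" by blast
  moreover have "card \<dots> = card (singular \<inter> W) - card (Y \<inter> W)"
    by (rule card_Diff_subset) (use assms in \<open>auto simp: ovoid_set_def\<close>)
  ultimately show "card ((singular - Y) \<inter> W) = 7 - m"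
    using assms W card_plane_singular[OF W] by (auto simp: ovoid_set_def)
qed blast

text \<open>The values 0, 1, 2 are excluded for \<open>Y\<close>, and 7, 6, 5 by the same arguments
  for its complement. For \<open>m = 0\<close> the set is empty because every singular vector lies
  in a plane.\<close>

lemma nontrivial_ovoid:
  assumes Y: "ovoid_set m Y" and "Y \<noteq> {}" "Y \<noteq> singular"
  shows "m = 3 \<or> m = 4"
proof -
  have Y_sub: "Y \<subseteq> singular" using Y by (simp add: ovoid_set_def)
  have zero: "Z = {}" if "ovoid_set 0 Z" for Z
  proof (rule equals0I)
    fix x assume x: "x \<in> Z"
    then have "x \<in> singular" using that by (auto simp: ovoid_set_def)
    then obtain W where "tot_sing q W" "card W = 8" "x \<in> W" by (rule singular_in_plane)
    then have "card (Z \<inter> W) = 0" "x \<in> Z \<inter> W" using that x by (auto simp: ovoid_set_def)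
    then show False by auto
  qed
  note C = ovoid_complement[OF Y]
  obtain x where "x \<in> singular" using singular_nonempty by blast
  then obtain W where W: "tot_sing q W" "card W = 8" by (rule singular_in_plane)
  then have "m = card (Y \<inter> W)" using Y by (auto simp: ovoid_set_def)
  also have "\<dots> \<le> card (singular \<inter> W)" by (rule card_mono) (use Y_sub in auto)
  finally have "m \<le> 7" using card_plane_singular[OF W] by simp
  moreover have "m \<noteq> 0" using zero[of Y] Y assms by auto
  moreover have "m \<noteq> 1" using no_1_ovoid[of Y] Y Y_sub assms by auto
  moreover have "m \<noteq> 2" using no_2_ovoid[of Y] Y assms by auto
  moreover have "m \<noteq> 5" using no_2_ovoid[of "singular - Y"] C Y_sub assms by auto
  moreover have "m \<noteq> 6"
  proof
    assume "m = 6"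
    then have "singular \<subseteq> singular - Y" using no_1_ovoid C by simp
    then show False using Y_sub assms by blast
  qed
  moreover have "m \<noteq> 7" using zero[of "singular - Y"] C Y_sub assms by auto
  ultimately show ?thesis by presburger
qed

lemma ovoid_3_nontrivial:
  assumes "ovoid_set 3 Y"
  shows "Y \<noteq> {}" "Y \<noteq> singular"
proof -
  obtain x where "x \<in> singular" using singular_nonempty by blast
  then obtain W where W: "tot_sing q W" "card W = 8" by (rule singular_in_plane)
  then have "card (Y \<inter> W) = 3" "card (singular \<inter> W) = 7"
    using assms card_plane_singular by (auto simp: ovoid_set_def)
  then show "Y \<noteq> {}" "Y \<noteq> singular" by auto
qed

definition ovoid_lines :: "'v set \<Rightarrow> 'v set set" where
  "ovoid_lines Y = {l. tot_sing q l \<and> card l = 4 \<and> l - {0} \<subseteq> Y}"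

lemma ovoid_3_lines:
  assumes Y: "ovoid_set 3 Y" and x: "x \<in> Y"
  shows "\<exists>!l. l \<in> ovoid_lines Y \<and> x \<in> l"
proof -
  obtain p where p: "p \<in> Y" "x + p \<in> Y"
    and uniq: "\<And>r. r \<in> Y \<Longrightarrow> x + r \<in> Y \<Longrightarrow> r = p \<or> r = x + p"
    using ovoid_3_line[OF Y x] by metis
  have sing: "x \<in> singular" "p \<in> singular" "x + p \<in> singular"
    using Y x p by (auto simp: ovoid_set_def)
  define l where "l = {0, x} \<union> (+) p ` {0, x}"
  have l_eq: "l = {0, x, p, x + p}" by (auto simp: l_def add.commute)
  have "\<not> q p" "\<And>z. z \<in> {0, x} \<Longrightarrow> \<not> b p z" "p \<notin> {0, x}"
    using sing not_b_commute by (auto simp: singular_def)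
  from tot_sing_translate[OF _ this, folded l_def]
  have l: "tot_sing q l" "card l = 4"
    using tot_sing_two[of x] sing by (auto simp: singular_def)
  show ?thesis
  proof (rule ex1I[of _ l])
    show "l \<in> ovoid_lines Y \<and> x \<in> l" using l x p by (auto simp: ovoid_lines_def l_eq)
    fix l' assume l': "l' \<in> ovoid_lines Y \<and> x \<in> l'"
    \<comment> \<open>A vector \<open>r\<close> of \<open>l'\<close> other than \<open>0\<close> and
      \<open>x\<close> gives a pair \<open>r\<close>, \<open>x + r\<close> in \<open>Y\<close>,
      which by uniqueness lies in \<open>l\<close>; both lines have 4 elements.\<close>
    have "l' \<subseteq> l"
    proof
      fix r assume r: "r \<in> l'"
      have "x + r \<in> l'" using l' r by (auto simp: ovoid_lines_def tot_sing_def add_closed_def)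
      then have "r = 0 \<or> r = x \<or> r \<in> Y \<and> x + r \<in> Y"
        using l' r by (auto simp: ovoid_lines_def)
      then show "r \<in> l" using uniq by (auto simp: l_eq)
    qed
    then show "l' = l" using l l' by (intro card_subset_eq) (auto simp: ovoid_lines_def)
  qed
qed

lemma Union_ovoid_lines:
  assumes Y: "ovoid_set 3 Y"
  shows "(\<Union>l\<in>ovoid_lines Y. l - {0}) = Y"
proof
  show "Y \<subseteq> (\<Union>l\<in>ovoid_lines Y. l - {0})"
  proof
    fix x assume x: "x \<in> Y"
    then obtain l where "l \<in> ovoid_lines Y" "x \<in> l" using ovoid_3_lines[OF Y] by blast
    moreover have "x \<noteq> 0" using x Y by (auto simp: ovoid_set_def singular_def)
    ultimately show "x \<in> (\<Union>l\<in>ovoid_lines Y. l - {0})" by blast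
  qed
qed (auto simp: ovoid_lines_def)

lemma ovoid_lines_disjoint:
  assumes Y: "ovoid_set 3 Y" and "l \<in> ovoid_lines Y" "l' \<in> ovoid_lines Y" "l \<noteq> l'"
  shows "(l - {0}) \<inter> (l' - {0}) = {}"
proof (rule equals0I)
  fix x assume x: "x \<in> (l - {0}) \<inter> (l' - {0})"
  then have "x \<in> Y" using assms by (auto simp: ovoid_lines_def)
  then show False using ovoid_3_lines[OF Y] x assms by blast
qed

lemma card_ovoid_line: "l \<in> ovoid_lines Y \<Longrightarrow> card (l - {0}) = 3"
  by (auto simp: ovoid_lines_def tot_sing_def add_closed_def)

text \<open>The lines without \<open>0\<close> partition the 51 elements of \<open>Y\<close> into
  triples.\<close>

lemma card_ovoid_lines:
  assumes Y: "ovoid_set 3 Y"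
  shows "card (ovoid_lines Y) = 17"
proof -
  have "card (\<Union>l\<in>ovoid_lines Y. l - {0}) = (\<Sum>l\<in>ovoid_lines Y. card (l - {0}))"
    by (rule card_UN_disjoint) (use ovoid_lines_disjoint[OF Y] in auto)
  then have "card Y = card (ovoid_lines Y) * 3"
    using card_ovoid_line Union_ovoid_lines[OF Y] by simp
  then show ?thesis using ovoid_card[OF Y] by simp
qed

text \<open>The three points of \<open>l\<close> exhaust those of \<open>Y\<close> in the plane, so
  the plane misses every other line contained in \<open>Y\<close>, as a 1-system requires.\<close>

lemma ovoid_line_in_plane:
  assumes Y: "ovoid_set 3 Y" and l: "l \<in> ovoid_lines Y"
    and W: "tot_sing q W" "card W = 8" "l \<subseteq> W"
  shows "Y \<inter> W = l - {0}"
proof -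
  have "l - {0} \<subseteq> Y \<inter> W" using l W by (auto simp: ovoid_lines_def)
  moreover have "card (Y \<inter> W) = 3" using Y W by (auto simp: ovoid_set_def)
  ultimately show ?thesis using card_ovoid_line[OF l] by (intro card_subset_eq[symmetric]) auto
qed

end

section \<open>Vector spaces over the field with two elements\<close>

lemma bit_add_eq_1: "x + y = 1 \<longleftrightarrow> (x = 1) \<noteq> (y = 1)" for x y :: bit
  by (cases x; cases y) simp_all

lemma bit_vec_add_self: "x + x = 0" for x :: "bit ^ 'n"
proof -
  have "c + c = 0" for c :: bit by (cases c) simp_all
  then show ?thesis by (simp add: vec_eq_iff del: add_bit_eq_xor)
qed

lemma CARD_bit: "CARD(bit) = 2"
proof -
  have "(UNIV :: bit set) = {0, 1}" by auto
  then show ?thesis by (metis card_2_iff zero_neq_one)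
qed

lemma bit_scale: "c *s x = (if c = 1 then x else 0)" for x :: "bit ^ 'n"
  by (cases c) simp_all

lemma bit_ex: "(\<exists>c :: bit. P c) \<longleftrightarrow> P 0 \<or> P 1"
  by (metis bit_not_one_iff)

lemma subspace_bit: "vec.subspace W \<longleftrightarrow> add_closed W" for W :: "(bit ^ 'n) set"
  by (auto simp: vec.subspace_def add_closed_def bit_scale)

text \<open>Adjoining a vector outside the span adds one further coset and so doubles the
  size.\<close>

lemma card_span_bit:
  fixes S :: "(bit ^ 'n) set"
  assumes "finite S" "vec.independent S"
  shows "card (vec.span S) = 2 ^ card S"
  using assms
proof (induction S)
  case (insert a S)
  have a: "a \<notin> vec.span S" and S: "vec.independent S"
    using insert.prems insert.hyps by (auto simp: vec.independent_insert)
  have image: "x \<in> (+) a ` T \<longleftrightarrow> x - a \<in> T" for x T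
    by (auto intro: image_eqI[of _ _ "x - a"])
  have "(\<exists>k. x - k *s a \<in> vec.span S) \<longleftrightarrow> x \<in> vec.span S \<or> x - a \<in> vec.span S" for x
    unfolding bit_ex by simp
  then have "vec.span (insert a S) = vec.span S \<union> (+) a ` vec.span S"
    unfolding vec.span_insert by (auto simp: image)
  moreover have "vec.span S \<inter> (+) a ` vec.span S = {}"
  proof (rule equals0I)
    fix x assume "x \<in> vec.span S \<inter> (+) a ` vec.span S"
    then have "x \<in> vec.span S" "x - a \<in> vec.span S" by (auto simp: image)
    then have "x - (x - a) \<in> vec.span S" by (rule vec.span_diff)
    then show False using a by simp
  qed
  moreover have "card ((+) a ` vec.span S) = card (vec.span S)"
    by (rule card_image) (auto simp: inj_on_def)
  ultimately have "card (vec.span (insert a S)) = 2 * card (vec.span S)"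
    by (simp add: card_Un_disjoint)
  then show ?case using insert S by simp
qed simp

lemma card_subspace_bit:
  fixes W :: "(bit ^ 'n) set"
  assumes "vec.subspace W"
  shows "card W = 2 ^ vec.dim W"
proof -
  obtain S where S: "S \<subseteq> W" "vec.independent S" "W \<subseteq> vec.span S" "card S = vec.dim W"
    using vec.basis_exists .
  then have "vec.span S = W" using assms by (metis vec.span_minimal subset_antisym)
  then show ?thesis using card_span_bit[of S] S by simp
qed

lemma totally_singular_bit:
  "totally_singular Q W \<longleftrightarrow> tot_sing (\<lambda>x. Q x = 1) W" for Q :: "bit ^ 'n \<Rightarrow> bit"
  by (simp add: totally_singular_def tot_sing_def subspace_bit)

lemma dim_eq_bit:
  fixes W :: "(bit ^ 'n) set"
  assumes "vec.subspace W"
  shows "vec.dim W = n \<longleftrightarrow> card W = 2 ^ n"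
  using card_subspace_bit[OF assms] by simp

lemma elliptic_space_bit:
  fixes Q :: "bit ^ 8 \<Rightarrow> bit"
  assumes Q: "elliptic_form Q"
  shows "elliptic_space (\<lambda>x. Q x = 1) (\<lambda>x y. polar Q x y = 1)"
proof
  fix x y z :: "bit ^ 8" and W :: "(bit ^ 8) set"
  show "x + x = 0" by (rule bit_vec_add_self)
  show "Q (x + y) = 1 \<longleftrightarrow> ((Q x = 1) \<noteq> (Q y = 1)) \<noteq> (polar Q x y = 1)"
    unfolding polar_def minus_bit_def bit_add_eq_1 by blast
  interpret linear: Vector_Spaces.linear "(*s)" "(*)" "polar Q x"
    using Q by (simp add: elliptic_form_def quadratic_form_def)
  show "polar Q x (y + z) = 1 \<longleftrightarrow> (polar Q x y = 1) \<noteq> (polar Q x z = 1)"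
    unfolding linear.add bit_add_eq_1 ..
  show "x = 0" if "Q x \<noteq> 1" "\<And>y. polar Q x y \<noteq> 1"
    using Q that by (simp add: elliptic_form_def nondegenerate_def)
  show "card W \<le> 8" if "tot_sing (\<lambda>x. Q x = 1) W"
  proof -
    have W: "totally_singular Q W" using that by (simp add: totally_singular_bit)
    have "finite {vec.dim W | W. totally_singular Q W}" by simp
    then have "vec.dim W \<le> witt_index Q"
      unfolding witt_index_def by (rule Max_ge) (use W in blast)
    then have "vec.dim W \<le> 3" using Q by (simp add: elliptic_form_def)
    then have "2 ^ vec.dim W \<le> (2 ^ 3 :: nat)" by (rule power_increasing) simp
    then show ?thesis
      using card_subspace_bit[of W] W by (simp add: totally_singular_def)
  qed
  show "CARD(bit ^ 8) = 256" by (simp add: CARD_bit)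
qed

section \<open>Transfer from non-zero vectors to points of the quadric\<close>

definition point :: "bit ^ 'n \<Rightarrow> (bit ^ 'n) set" where
  "point z = {0, z}"

lemma inj_point: "inj point"
  by (auto simp: inj_on_def point_def doubleton_eq_iff)

lemma point_iff: "vec.subspace P \<and> vec.dim P = 1 \<longleftrightarrow> (\<exists>z. z \<noteq> 0 \<and> P = point z)"
  for P :: "(bit ^ 'n) set"
proof
  assume P: "vec.subspace P \<and> vec.dim P = 1"
  then have "card P = 2" using dim_eq_bit[of P 1] by simp
  moreover have "0 \<in> P" using P vec.subspace_0 by blast
  ultimately show "\<exists>z. z \<noteq> 0 \<and> P = point z"
    unfolding point_def card_2_iff by (metis insertE insert_commute singletonD)
next
  assume "\<exists>z. z \<noteq> 0 \<and> P = point z"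
  then obtain z where z: "z \<noteq> 0" "P = {0, z}" by (auto simp: point_def)
  then have P: "vec.subspace P" by (auto simp: subspace_bit add_closed_def bit_vec_add_self)
  moreover have "card P = 2" using z by simp
  ultimately show "vec.subspace P \<and> vec.dim P = 1" using dim_eq_bit[OF P, of 1] by simp
qed

lemma points_on_bit:
  fixes W :: "(bit ^ 'n) set"
  assumes "0 \<in> W"
  shows "points_on W = point ` (W - {0})"
proof -
  have "P \<in> points_on W \<longleftrightarrow> (\<exists>z. z \<noteq> 0 \<and> P = point z) \<and> P \<subseteq> W" for P
    unfolding points_on_def point_iff[symmetric] by blast
  then show ?thesis using assms by (auto simp: point_def)
qed

text \<open>Writing \<open>Q z \<noteq> 1\<close> for singularity matches the definition of
  \<open>singular\<close> for the encoded form.\<close>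

lemma quadric_points_bit:
  fixes Q :: "bit ^ 'n \<Rightarrow> bit"
  assumes "Q 0 = 0"
  shows "quadric_points Q = point ` {z. z \<noteq> 0 \<and> Q z \<noteq> 1}"
proof -
  have "P \<in> quadric_points Q \<longleftrightarrow> (\<exists>z. z \<noteq> 0 \<and> P = point z) \<and> (\<forall>w\<in>P. Q w = 0)" for P
    unfolding quadric_points_def totally_singular_def point_iff[symmetric] by blast
  then show ?thesis using assms by (auto simp: point_def)
qed

theorem theorem4p2:
  fixes Q :: "bit ^ 8 \<Rightarrow> bit"
  assumes "elliptic_form Q"
  shows "(\<forall>m. (\<exists>X. m_ovoid Q m X \<and> \<not> trivial_ovoid Q X) \<longleftrightarrow> m = 3 \<or> m = 4) \<and>
         (\<forall>X. m_ovoid Q 3 X \<longrightarrow> (\<exists>L. one_system Q L \<and> X = (\<Union>l\<in>L. points_on l)))"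
proof -
  interpret elliptic_space "\<lambda>x. Q x = 1" "\<lambda>x y. polar Q x y = 1"
    by (rule elliptic_space_bit[OF assms])
  have points: "quadric_points Q = point ` singular"
    unfolding singular_def by (rule quadric_points_bit) (use q_zero bit_not_one_iff in blast)
  have planes: "W \<in> quadric_planes Q \<longleftrightarrow> tot_sing (\<lambda>x. Q x = 1) W \<and> card W = 8" for W
    using dim_eq_bit[of W 3] unfolding quadric_planes_def totally_singular_bit[symmetric]
    by (auto simp: totally_singular_def)
  have lines: "W \<in> quadric_lines Q \<longleftrightarrow> tot_sing (\<lambda>x. Q x = 1) W \<and> card W = 4" for W
    using dim_eq_bit[of W 2] unfolding quadric_lines_def totally_singular_bit[symmetric]
    by (auto simp: totally_singular_def)
  have on: "points_on W = point ` (W - {0})" if "tot_sing (\<lambda>x. Q x = 1) W" for W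
    by (rule points_on_bit) (use that in \<open>simp add: tot_sing_def add_closed_def\<close>)
  \<comment> \<open>Since \<open>point\<close> is injective and \<open>0\<close> is not in
    \<open>Y\<close>, counting points amounts to counting vectors.\<close>
  have ovoid: "m_ovoid Q m (point ` Y) \<longleftrightarrow> ovoid_set m Y" if Y: "Y \<subseteq> singular" for m Y
  proof -
    have "card (point ` Y \<inter> points_on W) = card (Y \<inter> W)" if "tot_sing (\<lambda>x. Q x = 1) W" for W
    proof -
      have "Y \<inter> W = Y \<inter> (W - {0})" using Y by (auto simp: singular_def)
      then have "point ` Y \<inter> points_on W = point ` (Y \<inter> W)"
        unfolding on[OF that] image_Int[OF inj_point, symmetric] by simp
      then show ?thesis by (simp add: card_image inj_on_subset[OF inj_point])
    qed
    then show ?thesis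
      using Y unfolding m_ovoid_def ovoid_set_def points by (auto simp: planes)
  qed
  have ovoidE: "\<exists>Y. X = point ` Y \<and> ovoid_set m Y" if X: "m_ovoid Q m X" for m X
  proof -
    obtain Y where "Y \<subseteq> singular" "X = point ` Y"
      using X unfolding m_ovoid_def points by (meson subset_imageE)
    then show ?thesis using ovoid X by blast
  qed
  have trivial: "trivial_ovoid Q (point ` Y) \<longleftrightarrow> Y = {} \<or> Y = singular" for Y
    unfolding trivial_ovoid_def points by (simp add: inj_image_eq_iff[OF inj_point])
  have ex: "\<exists>X. m_ovoid Q m X \<and> \<not> trivial_ovoid Q X"
    if "ovoid_set m Y" "Y \<noteq> {}" "Y \<noteq> singular" for m Y
    using that ovoid[of Y m] trivial[of Y] by (auto simp: ovoid_set_def)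
  have "(\<exists>X. m_ovoid Q m X \<and> \<not> trivial_ovoid Q X) \<longleftrightarrow> m = 3 \<or> m = 4" for m
  proof
    assume "\<exists>X. m_ovoid Q m X \<and> \<not> trivial_ovoid Q X"
    then obtain Y where "ovoid_set m Y" "Y \<noteq> {}" "Y \<noteq> singular"
      using ovoidE trivial by metis
    then show "m = 3 \<or> m = 4" by (rule nontrivial_ovoid)
  next
    assume m: "m = 3 \<or> m = 4"
    obtain Y where Y: "ovoid_set 3 Y" using ovoid_3_exists by blast
    note nontriv = ovoid_3_nontrivial[OF Y]
    have "Y \<subseteq> singular" using Y by (simp add: ovoid_set_def)
    then have "singular - Y \<noteq> {}" "singular - Y \<noteq> singular" using nontriv by auto
    \<comment> \<open>The complement of a 3-ovoid settles the existence for
      \<open>m = 4\<close>.\<close>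
    moreover have "ovoid_set 4 (singular - Y)" using ovoid_complement[OF Y] by simp
    ultimately show "\<exists>X. m_ovoid Q m X \<and> \<not> trivial_ovoid Q X"
      using m ex[OF Y nontriv] ex by blast
  qed
  moreover have "\<exists>L. one_system Q L \<and> X = (\<Union>l\<in>L. points_on l)" if X: "m_ovoid Q 3 X" for X
  proof -
    obtain Y where XY: "X = point ` Y" and Y: "ovoid_set 3 Y" using ovoidE[OF X] by blast
    let ?L = "ovoid_lines Y"
    have on_line: "points_on l = point ` (l - {0})" if "l \<in> ?L" for l
      using that on by (simp add: ovoid_lines_def)
    have disj: "disjnt (points_on l) (points_on l')" if "l \<in> ?L" "l' \<in> ?L" "l \<noteq> l'" for l l'
      unfolding on_line[OF that(1)] on_line[OF that(2)] disjnt_def image_Int[OF inj_point, symmetric]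
        ovoid_lines_disjoint[OF Y that] by simp
    have X_eq: "X = (\<Union>l\<in>?L. points_on l)"
    proof -
      have "X = (\<Union>l\<in>?L. point ` (l - {0}))"
        using Union_ovoid_lines[OF Y] unfolding XY image_UN[symmetric] by simp
      then show ?thesis using on_line by simp
    qed
    have "disjnt (points_on \<pi>) (\<Union>l'\<in>?L - {l}. points_on l')"
      if l: "l \<in> ?L" and \<pi>: "\<pi> \<in> quadric_planes Q" "l \<subseteq> \<pi>" for l \<pi>
    proof -
      have W: "tot_sing (\<lambda>x. Q x = 1) \<pi>" "card \<pi> = 8" using \<pi> by (auto simp: planes)
      have "0 \<notin> Y" using Y by (auto simp: ovoid_set_def singular_def)
      \<comment> \<open>All points of \<open>X\<close> in the plane lie on \<open>l\<close>, whereas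
        the other lines are contained in \<open>X\<close> and miss \<open>l\<close>.\<close>
      then have "X \<inter> points_on \<pi> = points_on l"
        unfolding XY on[OF W(1)] on_line[OF l] image_Int[OF inj_point, symmetric]
          ovoid_line_in_plane[OF Y l W \<pi>(2), symmetric] by (intro arg_cong[where f = "(`) point"]) auto
      moreover have "(\<Union>l'\<in>?L - {l}. points_on l') \<subseteq> X" using X_eq by blast
      moreover have "disjnt (points_on l) (\<Union>l'\<in>?L - {l}. points_on l')"
        using disj[OF l] by (auto simp: disjnt_def)
      ultimately show ?thesis unfolding disjnt_def by blast
    qed
    moreover have "?L \<subseteq> quadric_lines Q" using lines by (auto simp: ovoid_lines_def)
    ultimately have "one_system Q ?L"
      using card_ovoid_lines[OF Y] disj by (auto simp: one_system_def CARD_bit pairwise_def)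
    then show ?thesis using X_eq by blast
  qed
  ultimately show ?thesis by blast
qed

end
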